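(* Let $e,d\ge 1$, and let $\Lambda$ and $\Lambda'$ be two cut-and-project sets in $\mathbb{R}^e$ defined with the same internal space $\mathbb{R}^d$, the same lattice $\Gamma\subset\mathbb{R}^e\times\mathbb{R}^d$ and the same projections $\pi_1:\mathbb{R}^e\times\mathbb{R}^d\to\mathbb{R}^e$ and $\pi_2:\mathbb{R}^e\times\mathbb{R}^d\to\mathbb{R}^d$, but with different windows $W\subset\mathbb{R}^d$ and $W'\subset\mathbb{R}^d$, respectively. If $W$ and $W'$ are $\pi_2(\Gamma)$-equidecomposable, then $\Lambda$ and $\Lambda'$ are bounded distance equivalent.
   Context: Cut-and-project set (CPS): Let $G=\mathbb{R}^e$, $H=\mathbb{R}^d$, let $\Gamma$ be a lattice (discrete cocompact subgroup) in $G\times H$, let $W\subset H$ be relatively compact (the window), and let $\pi_1,\pi_2$ be the projections of $G\times H$ to $G$ and to $H$, respectively, such that $\pi_1|_\Gamma$ is one-to-one and $\pi_2(\Gamma)$ is dense in $W$ (i.e. $W$ is contained in the closure of $\pi_2(\Gamma)$). The corresponding CPS is $\Lambda=\{\pi_1(x)\mid x\in\Gamma,\ \pi_2(x)\in W\}$. Equidecomposability: Let $X,Y\subset\mathbb{R}^d$ and let $V$ be a set of vectors in $\mathbb{R}^d$. $X$ and $Y$ are $V$-equidecomposable if there are a natural number $k$, a decomposition $X=X_1\cup\dots\cup X_k$ into $k$ pairwise disjoint subsets, and vectors $\mathbf{v}_1,\dots,\mathbf{v}_k\in V$ such that $Y=(X_1+\mathbf{v}_1)\cup\dots\cup(X_k+\mathbf{v}_k)$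 with this union also disjoint. Bounded distance equivalence: Two discrete point sets $\Lambda,\Lambda'\subset\mathbb{R}^e$ are bounded distance equivalent if there are $c>0$ and a bijection $\varphi:\Lambda\to\Lambda'$ with $|x-\varphi(x)|<c$ for all $x\in\Lambda$. *)

theory Defs
  imports "HOL-Analysis.Analysis"
begin

definition additive_subgroup :: "'a::ab_group_add set \<Rightarrow> bool" where
  "additive_subgroup \<Gamma> \<longleftrightarrow> 0 \<in> \<Gamma> \<and> (\<forall>x\<in>\<Gamma>. \<forall>y\<in>\<Gamma>. x + y \<in> \<Gamma>) \<and> (\<forall>x\<in>\<Gamma>. - x \<in> \<Gamma>)"

definition coset_of :: "'a::ab_group_add set \<Rightarrow> 'a \<Rightarrow> 'a set" where
  "coset_of \<Gamma> x = (+) x ` \<Gamma>"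

text \<open>The quotient of the ambient space by \<open>\<Gamma>\<close>: its points are the cosets of \<open>\<Gamma>\<close>, and it
  carries the quotient topology (justified by \<open>quotient_map_coset_of\<close> below).\<close>

definition quotient_by :: "'a::{ab_group_add,topological_space} set \<Rightarrow> 'a set topology" where
  "quotient_by \<Gamma> = topology (\<lambda>\<U>. \<U> \<subseteq> range (coset_of \<Gamma>) \<and> open (coset_of \<Gamma> -` \<U>))"

lemma openin_quotient_by:
  "openin (quotient_by \<Gamma>) \<U> \<longleftrightarrow> \<U> \<subseteq> range (coset_of \<Gamma>) \<and> open (coset_of \<Gamma> -` \<U>)"
proof -
  have "istopology (\<lambda>\<U>. \<U> \<subseteq> range (coset_of \<Gamma>) \<and> open (coset_of \<Gamma> -` \<U>))"
    unfolding istopology_def by (auto simp: vimage_Union)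
  then show ?thesis
    by (simp add: quotient_by_def topology_inverse')
qed

lemma topspace_quotient_by: "topspace (quotient_by \<Gamma>) = range (coset_of \<Gamma>)"
proof
  show "topspace (quotient_by \<Gamma>) \<subseteq> range (coset_of \<Gamma>)"
    using openin_quotient_by openin_topspace by blast
  have "coset_of \<Gamma> -` range (coset_of \<Gamma>) = UNIV"
    by auto
  then have "openin (quotient_by \<Gamma>) (range (coset_of \<Gamma>))"
    by (simp add: openin_quotient_by)
  then show "range (coset_of \<Gamma>) \<subseteq> topspace (quotient_by \<Gamma>)"
    by (rule openin_subset)
qed

lemma quotient_map_coset_of: "quotient_map euclidean (quotient_by \<Gamma>) (coset_of \<Gamma>)"
  by (auto simp: quotient_map_def topspace_quotient_by openin_quotient_by vimage_def)

definition lattice_subgroup :: "'a::{ab_group_add,topological_space} set \<Rightarrow> bool" where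
  "lattice_subgroup \<Gamma> \<longleftrightarrow> additive_subgroup \<Gamma> \<and> discrete \<Gamma> \<and> compact_space (quotient_by \<Gamma>)"

text \<open>The projections onto the physical space \<open>'a\<close> and the internal space \<open>'b\<close>
  are \<^const>\<open>fst\<close> and \<^const>\<open>snd\<close>.\<close>

definition cut_and_project_data ::
  "('a::euclidean_space \<times> 'b::euclidean_space) set \<Rightarrow> 'b set \<Rightarrow> bool" where
  "cut_and_project_data \<Gamma> W \<longleftrightarrow>
     lattice_subgroup \<Gamma> \<and> compact (closure W) \<and> inj_on fst \<Gamma> \<and> W \<subseteq> closure (snd ` \<Gamma>)"

definition cut_and_project_set ::
  "('a::euclidean_space \<times> 'b::euclidean_space) set \<Rightarrow> 'b set \<Rightarrow> 'a set" where
  "cut_and_project_set \<Gamma> W = {fst x | x. x \<in> \<Gamma> \<and> snd x \<in> W}"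

definition equidecomposable :: "'a::ab_group_add set \<Rightarrow> 'a set \<Rightarrow> 'a set \<Rightarrow> bool" where
  "equidecomposable V X Y \<longleftrightarrow>
     (\<exists>(k::nat) P v.
        (\<forall>i\<in>{1..k}. v i \<in> V) \<and>
        disjoint_family_on P {1..k} \<and> X = (\<Union>i\<in>{1..k}. P i) \<and>
        disjoint_family_on (\<lambda>i. (\<lambda>x. x + v i) ` P i) {1..k} \<and>
        Y = (\<Union>i\<in>{1..k}. (\<lambda>x. x + v i) ` P i))"

text \<open>The notion is only defined for discrete sets, so discreteness of both sets is part of the
  relation.\<close>

definition bounded_distance_equivalent :: "'a::euclidean_space set \<Rightarrow> 'a set \<Rightarrow> bool" where
  "bounded_distance_equivalent \<Lambda> \<Lambda>' \<longleftrightarrow>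
     discrete \<Lambda> \<and> discrete \<Lambda>' \<and>
     (\<exists>c>0. \<exists>\<phi>. bij_betw \<phi> \<Lambda> \<Lambda>' \<and> (\<forall>x\<in>\<Lambda>. norm (x - \<phi> x) < c))"

end

theory Submission
  imports Defs
begin

text \<open>
  A piece \<open>P i\<close> of the window that moves by \<open>v i = snd (g i)\<close>, with \<open>g i \<in> \<Gamma>\<close>, corresponds in the
  lattice to the points of \<open>\<Gamma>\<close> lying over \<open>P i\<close>, and these can be moved by \<open>g i\<close> itself without
  leaving \<open>\<Gamma>\<close>. So an equidecomposition of the windows lifts to a bijection between the parts of the
  lattice over \<open>W\<close> and over \<open>W'\<close> whose displacements take finitely many values
  (\<open>equidecomposable_lifts_to_subgroup\<close>). As \<open>fst\<close> is injective on \<open>\<Gamma>\<close>, this bijection descends to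
  the cut-and-project sets, and finitely many displacements are bounded.

  It remains to see that a cut-and-project set is discrete
  (\<open>discrete_cut_and_project_set\<close>): the lattice points over a ball in physical space and over the
  bounded window form a bounded set, and a discrete subgroup meets bounded sets in finite sets.
\<close>

text \<open>Translating by elements of the subgroup carries an isolating ball around \<open>0\<close> to every other
  point, so one radius serves them all.\<close>

lemma discrete_subgroup_imp_uniform_discrete:
  fixes \<Gamma> :: "'a::real_normed_vector set"
  assumes "additive_subgroup \<Gamma>" "discrete \<Gamma>"
  shows "uniform_discrete \<Gamma>"
proof -
  have diff: "x - y \<in> \<Gamma>" if "x \<in> \<Gamma>" "y \<in> \<Gamma>" for x y
    using assms(1) that unfolding additive_subgroup_def
    by (auto simp: diff_conv_add_uminus simp del: add_uminus_conv_diff)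
  have "0 \<in> \<Gamma>"
    using assms(1) by (simp add: additive_subgroup_def)
  then obtain e where e: "e > 0" "\<And>z. z \<in> \<Gamma> \<Longrightarrow> dist 0 z < e \<Longrightarrow> z = 0"
    using discreteD[OF assms(2), of 0] unfolding isolated_in_dist_Ex_iff by blast
  show ?thesis
  proof (rule uniformI1[OF e(1)])
    fix x y assume "x \<in> \<Gamma>" "y \<in> \<Gamma>" "dist x y < e"
    then have "x - y = 0"
      using e(2)[OF diff, of x y] by (simp add: dist_norm norm_minus_commute)
    then show "x = y" by simp
  qed
qed

lemma finite_discrete_subgroup_Int_bounded:
  fixes \<Gamma> :: "'a::euclidean_space set"
  assumes "additive_subgroup \<Gamma>" "discrete \<Gamma>" "bounded B"
  shows "finite (\<Gamma> \<inter> B)"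
proof -
  have "uniform_discrete (\<Gamma> \<inter> B)"
    using discrete_subgroup_imp_uniform_discrete[OF assms(1,2)]
    by (rule uniform_discrete_subset) simp
  moreover have "bounded (\<Gamma> \<inter> B)"
    using assms(3) by (rule bounded_subset) simp
  ultimately show ?thesis
    using uniform_discrete_finite_iff by blast
qed

lemma cut_and_project_set_eq_image:
  "cut_and_project_set \<Gamma> W = fst ` (\<Gamma> \<inter> snd -` W)"
  unfolding cut_and_project_set_def by blast

lemma discrete_cut_and_project_set:
  assumes "additive_subgroup \<Gamma>" "discrete \<Gamma>" "bounded W"
  shows "discrete (cut_and_project_set \<Gamma> W)"
proof (rule discreteI)
  fix x assume x: "x \<in> cut_and_project_set \<Gamma> W"
  have "finite (\<Gamma> \<inter> ball x 1 \<times> W)"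
    using assms by (intro finite_discrete_subgroup_Int_bounded bounded_Times bounded_ball)
  moreover have "cut_and_project_set \<Gamma> W \<inter> ball x 1 \<subseteq> fst ` (\<Gamma> \<inter> ball x 1 \<times> W)"
    by (force simp: cut_and_project_set_eq_image)
  ultimately have "finite (cut_and_project_set \<Gamma> W \<inter> ball x 1)"
    by (meson finite_imageI finite_subset)
  then have "\<not> x islimpt cut_and_project_set \<Gamma> W"
    unfolding islimpt_eq_infinite_ball by (metis zero_less_one)
  with x show "x isolated_in cut_and_project_set \<Gamma> W"
    by (simp add: isolated_in_islimpt_iff)
qed

text \<open>The lift moves a point over the piece \<open>P i\<close> by a fixed preimage \<open>g i \<in> \<Gamma>\<close> of \<open>v i\<close>.
  Disjointness of the pieces makes it well defined, disjointness of their translates makes it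
  injective, and it is onto because \<open>g i\<close> may also be subtracted within \<open>\<Gamma>\<close>.\<close>

lemma equidecomposable_lifts_to_subgroup:
  fixes \<Gamma> :: "('a::ab_group_add \<times> 'b::ab_group_add) set"
  assumes \<Gamma>: "additive_subgroup \<Gamma>" and "equidecomposable (snd ` \<Gamma>) W W'"
  obtains \<Phi> T where "finite T" "bij_betw \<Phi> (\<Gamma> \<inter> snd -` W) (\<Gamma> \<inter> snd -` W')"
    "\<And>x. x \<in> \<Gamma> \<inter> snd -` W \<Longrightarrow> \<Phi> x - x \<in> T"
proof -
  have add: "x + y \<in> \<Gamma>" and diff: "x - y \<in> \<Gamma>" if "x \<in> \<Gamma>" "y \<in> \<Gamma>" for x y
    using \<Gamma> that unfolding additive_subgroup_def
    by (auto simp: diff_conv_add_uminus simp del: add_uminus_conv_diff)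
  from assms(2) obtain k :: nat and P v where
    v: "\<forall>i\<in>{1..k}. v i \<in> snd ` \<Gamma>" and
    P: "disjoint_family_on P {1..k}" and W: "W = (\<Union>i\<in>{1..k}. P i)" and
    Q: "disjoint_family_on (\<lambda>i. (\<lambda>x. x + v i) ` P i) {1..k}" and
    W': "W' = (\<Union>i\<in>{1..k}. (\<lambda>x. x + v i) ` P i)"
    unfolding equidecomposable_def by blast
  from v have "\<forall>i\<in>{1..k}. \<exists>g\<in>\<Gamma>. snd g = v i" by force
  then obtain g where g: "\<And>i. i \<in> {1..k} \<Longrightarrow> g i \<in> \<Gamma>" "\<And>i. i \<in> {1..k} \<Longrightarrow> snd (g i) = v i"
    by metis
  from W have "\<forall>w\<in>W. \<exists>i\<in>{1..k}. w \<in> P i" by blast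
  then obtain piece where piece: "\<And>w. w \<in> W \<Longrightarrow> piece w \<in> {1..k}" "\<And>w. w \<in> W \<Longrightarrow> w \<in> P (piece w)"
    by metis
  have piece_eq: "piece w = i" if "i \<in> {1..k}" "w \<in> P i" for w i
  proof -
    have "w \<in> W" using W that by blast
    then show ?thesis
      using piece[of w] P that unfolding disjoint_family_on_def by blast
  qed
  define \<Phi> where "\<Phi> x = x + g (piece (snd x))" for x
  have maps: "\<Phi> x \<in> \<Gamma> \<inter> snd -` W'" if "x \<in> \<Gamma> \<inter> snd -` W" for x
    using that piece[of "snd x"] g[of "piece (snd x)"] add W' by (auto simp: \<Phi>_def)
  have inj: "inj_on \<Phi> (\<Gamma> \<inter> snd -` W)"
  proof (rule inj_onI)
    fix x y assume x: "x \<in> \<Gamma> \<inter> snd -` W" and y: "y \<in> \<Gamma> \<inter> snd -` W" and eq: "\<Phi> x = \<Phi> y"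
    let ?i = "piece (snd x)" and ?j = "piece (snd y)"
    have ij: "?i \<in> {1..k}" "?j \<in> {1..k}" "snd x \<in> P ?i" "snd y \<in> P ?j"
      using x y piece by auto
    have "snd x + v ?i = snd y + v ?j"
      using arg_cong[OF eq, of snd] g(2) ij by (simp add: \<Phi>_def)
    then have "snd x + v ?i \<in> (\<lambda>z. z + v ?i) ` P ?i \<inter> (\<lambda>z. z + v ?j) ` P ?j"
      using ij by (metis IntI imageI)
    then have "?i = ?j"
      using Q ij unfolding disjoint_family_on_def by blast
    with eq show "x = y" by (simp add: \<Phi>_def)
  qed
  have surj: "y \<in> \<Phi> ` (\<Gamma> \<inter> snd -` W)" if "y \<in> \<Gamma> \<inter> snd -` W'" for y
  proof -
    from that W' obtain i p where i: "i \<in> {1..k}" and p: "p \<in> P i" "snd y = p + v i" by auto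
    have s: "snd (y - g i) = p" using p(2) g(2)[OF i] by simp
    have "y - g i \<in> \<Gamma> \<inter> snd -` W"
      using that diff g(1)[OF i] s i p(1) W by auto
    moreover have "\<Phi> (y - g i) = y"
      by (simp only: \<Phi>_def s piece_eq[OF i p(1)] diff_add_cancel)
    ultimately show ?thesis by (metis imageI)
  qed
  show thesis
  proof
    show "finite (g ` {1..k})" by simp
    show "bij_betw \<Phi> (\<Gamma> \<inter> snd -` W) (\<Gamma> \<inter> snd -` W')"
      using inj maps surj by (auto intro!: bij_betw_imageI)
    show "\<Phi> x - x \<in> g ` {1..k}" if "x \<in> \<Gamma> \<inter> snd -` W" for x
      using that piece(1) by (auto simp: \<Phi>_def)
  qed
qed

theorem theorem6p1:
  fixes \<Gamma> :: "((real ^ 'e) \<times> (real ^ 'd)) set"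
    and W W' :: "(real ^ 'd) set"
  assumes "cut_and_project_data \<Gamma> W"
    and "cut_and_project_data \<Gamma> W'"
    and "equidecomposable (snd ` \<Gamma>) W W'"
  shows "bounded_distance_equivalent (cut_and_project_set \<Gamma> W) (cut_and_project_set \<Gamma> W')"
proof -
  let ?L = "\<Gamma> \<inter> snd -` W" and ?L' = "\<Gamma> \<inter> snd -` W'"
  have \<Gamma>: "additive_subgroup \<Gamma>" "discrete \<Gamma>" and inj: "inj_on fst \<Gamma>"
    using assms(1) by (auto simp: cut_and_project_data_def lattice_subgroup_def)
  have "bounded W" "bounded W'"
    using assms(1,2) compact_imp_bounded bounded_subset closure_subset
    unfolding cut_and_project_data_def by metis+
  then have "discrete (cut_and_project_set \<Gamma> W)" "discrete (cut_and_project_set \<Gamma> W')"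
    using \<Gamma> by (auto intro: discrete_cut_and_project_set)
  moreover
  obtain \<Phi> T where T: "finite T" and \<Phi>: "bij_betw \<Phi> ?L ?L'"
    and \<Phi>T: "\<And>x. x \<in> ?L \<Longrightarrow> \<Phi> x - x \<in> T"
    using equidecomposable_lifts_to_subgroup[OF \<Gamma>(1) assms(3)] by metis
  have fst_bij: "bij_betw fst ?L (cut_and_project_set \<Gamma> W)"
    "bij_betw fst ?L' (cut_and_project_set \<Gamma> W')"
    using inj by (auto simp: bij_betw_def cut_and_project_set_eq_image intro: inj_on_subset)
  define \<phi> where "\<phi> = fst \<circ> \<Phi> \<circ> the_inv_into ?L fst"
  have "bij_betw \<phi> (cut_and_project_set \<Gamma> W) (cut_and_project_set \<Gamma> W')"
    unfolding \<phi>_def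
    by (intro bij_betw_trans[OF bij_betw_the_inv_into[OF fst_bij(1)]]
        bij_betw_trans[OF \<Phi> fst_bij(2)])
  moreover
  obtain c where c: "c > 0" "\<And>t. t \<in> T \<Longrightarrow> norm t < c"
    using finite_imp_bounded[OF T] by (auto simp: bounded_pos_less)
  have "norm (y - \<phi> y) < c" if "y \<in> cut_and_project_set \<Gamma> W" for y
  proof -
    from that obtain x where x: "x \<in> ?L" "y = fst x"
      unfolding cut_and_project_set_eq_image by blast
    have "\<phi> y = fst (\<Phi> x)"
      using the_inv_into_f_f[OF bij_betw_imp_inj_on[OF fst_bij(1)] x(1)] x(2)
      by (simp add: \<phi>_def)
    then have "norm (y - \<phi> y) = norm (fst (\<Phi> x - x))"
      by (simp add: x(2) norm_minus_commute)
    also have "\<dots> \<le> norm (\<Phi> x - x)"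
      by (metis norm_fst_le prod.collapse)
    also have "\<dots> < c"
      by (rule c(2)[OF \<Phi>T[OF x(1)]])
    finally show ?thesis .
  qed
  ultimately show ?thesis
    unfolding bounded_distance_equivalent_def using c(1) by blast
qed

end
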